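(* Let $m_1\ne0$ be a real number. Consider the system for forms $\overset{r}{\omega}\in K^r(4)$, $r=0,1,2,3,4$: $$-\delta^c\overset{1}{\omega}=m_1\overset{0}{\omega},\quad d^c\overset{0}{\omega}-\delta^c\overset{2}{\omega}=0,\quad d^c\overset{1}{\omega}-\delta^c\overset{3}{\omega}=m_1\overset{2}{\omega},\quad d^c\overset{2}{\omega}-\delta^c\overset{4}{\omega}=0,\quad d^c\overset{3}{\omega}=m_1\overset{4}{\omega}.$$ This system is invariant under the transformation $$\overset{1}{\omega}\to\overset{1}{\omega}+d^c\overset{0}{\varphi},\qquad \overset{3}{\omega}\to\overset{3}{\omega}+\delta^c\overset{4}{\varphi}$$ (with $\overset{0}{\omega},\overset{2}{\omega},\overset{4}{\omega}$ unchanged), where the gauge forms $\overset{0}{\varphi}\in K^0(4)$ and $\overset{4}{\varphi}\in K^4(4)$ satisfy $\Delta^c\overset{0}{\varphi}=0$ and $\Delta^c\overset{4}{\varphi}=0$. That is, for all such gauge forms, $(\overset{0}{\omega},\overset{1}{\omega},\overset{2}{\omega},\overset{3}{\omega},\overset{4}{\omega})$ is a solution of the system if and only if $(\overset{0}{\omega},\overset{1}{\omega}+d^c\overset{0}{\varphi},\overset{2}{\omega},\overset{3}{\omega}+\delta^c\overset{4}{\varphi},\overset{4}{\omega})$ is.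
   Context: Chains. Let $C=C^0\oplus C^1$, where $C^0$ is the real vector space with basis $x_\kappa$ ($\kappa\in\mathbb Z$) and $C^1$ the real vector space with basis $e_\kappa$ ($\kappa\in\mathbb Z$); put $\tau\kappa=\kappa+1$, $\partial x_\kappa=0$, $\partial e_\kappa=x_{\tau\kappa}-x_\kappa$. Let $C(4)=C\otimes C\otimes C\otimes C$, with basis elements $s_k=s_{k_0}\otimes s_{k_1}\otimes s_{k_2}\otimes s_{k_3}$, $k=(k_0,k_1,k_2,k_3)\in\mathbb Z^4$, each $s_{k_i}$ being $x_{k_i}$ or $e_{k_i}$; the dimension of $s_k$ is the number of factors of type $e$. The boundary is extended by $\partial(a\otimes b)=\partial a\otimes b+(-1)^{\dim a}a\otimes\partial b$ and linearity. Cochains (discrete forms). $K(4)=K\otimes K\otimes K\otimes K$ is the dual complex of real cochains, with basis elements $s^k=s^{k_0}\otimes s^{k_1}\otimes s^{k_2}\otimes s^{k_3}$, each $s^{k_i}$ being $x^{k_i}$ or $e^{k_i}$. Forms are (possibly infinite) formal real linear combinations of basis elements. The pairing is $\langle \varepsilon_k,s^k\rangle=1$ if $\varepsilon_k=s_k$ is the corresponding basis chain and $0$ otherwise, extended linearly. $K^r(4)$ is the space of forms of degree $r$, $K(4)=\bigoplus_{r=0}^4K^r(4)$. The coboundary $d^c:K^r(4)\to K^{r+1}(4)$ is defined by $\langle\partial a,\omega\rangle=\langle a,d^c\omega\rangle$ for all $(r+1)$-chains $a$; $d^c\omega=0$ for $\omega\in K^4(4)$. Cup product. On $K$: $x^\kappa\cup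 x^\kappa=x^\kappa$, $e^\kappa\cup x^{\tau\kappa}=e^\kappa$, $x^\kappa\cup e^\kappa=e^\kappa$, and all other products of basis elements are $0$. Inductively, for basis elements $s_{(p)},s_{(q)}$ of the $n$-fold tensor product of $K$ (of degrees $p,q$) and basis elements $s^\kappa,s^\mu$ of $K$, $(s_{(p)}\otimes s^\kappa)\cup(s_{(q)}\otimes s^\mu)=Q(\kappa,q)\,(s_{(p)}\cup s_{(q)})\otimes(s^\kappa\cup s^\mu)$, where $Q(\kappa,q)=-1$ if both $s^\kappa$ and $s_{(q)}$ have odd degree and $Q(\kappa,q)=+1$ otherwise. Extend linearly. Star operator (Lorentz signature). $\ast:K^r(4)\to K^{4-r}(4)$ is the linear bijection sending a basis element $s^k$ to the unique element of the form $\pm$(basis element) with $s^k\cup\ast s^k=Q(k_0)e^k$, where $e^k=e^{k_0}\otimes e^{k_1}\otimes e^{k_2}\otimes e^{k_3}$, $Q(k_0)=+1$ if $s^{k_0}=x^{k_0}$ and $Q(k_0)=-1$ if $s^{k_0}=e^{k_0}$ (so, up to sign, $\ast$ replaces each factor $x^{k_i}$ by $e^{k_i}$ and each factor $e^{k_i}$ by $x^{\tau k_i}$). Codifferential and Laplacian. $\delta^c:K^{r+1}(4)\to K^r(4)$, $\delta^c\psi=(-1)^{r+1}\ast^{-1}d^c\ast\psi$ for $\psi\in K^{r+1}(4)$, $r=0,1,2,3$; $\delta^c\omega=0$ for $\omega\in K^0(4)$. $\Delta^c=-(d^c\delta^c+\delta^cd^c):K^r(4)\to K^r(4)$. *)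

theory Defs
  imports Complex_Main "HOL-Library.Function_Algebras"
begin

(* A chain or a form is given by its coefficients with respect to the basis: a
   function from the set of basis elements to the reals.  Chains have finite support,
   forms are arbitrary.  As K is dual to C, one type indexes both bases. *)

datatype cell = X int | E int

type_synonym 'b form = "'b \<Rightarrow> real"

definition basis :: "'b \<Rightarrow> 'b form" where
  "basis s = (\<lambda>t. if t = s then 1 else 0)"

definition scale :: "real \<Rightarrow> 'b form \<Rightarrow> 'b form" where
  "scale c f = (\<lambda>s. c * f s)"

definition tensor :: "'a form \<Rightarrow> 'b form \<Rightarrow> ('a \<times> 'b) form" where
  "tensor f g = (\<lambda>(s, t). f s * g t)"

(* Degree, boundary and cup product on basis elements; the instances below give
   the complexes C and K and their tensor products. *)

class graded_basis =
  fixes deg :: "'a \<Rightarrow> nat"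
    and boundary_basis :: "'a \<Rightarrow> 'a form"
    and cup_basis :: "'a \<Rightarrow> 'a \<Rightarrow> 'a form"

instantiation cell :: graded_basis
begin

fun deg_cell :: "cell \<Rightarrow> nat" where
  "deg_cell (X k) = 0"
| "deg_cell (E k) = 1"

fun boundary_basis_cell :: "cell \<Rightarrow> cell form" where
  "boundary_basis_cell (X k) = 0"
| "boundary_basis_cell (E k) = basis (X (k + 1)) - basis (X k)"

fun cup_basis_cell :: "cell \<Rightarrow> cell \<Rightarrow> cell form" where
  "cup_basis_cell (X k) (X l) = (if l = k then basis (X k) else 0)"
| "cup_basis_cell (E k) (X l) = (if l = k + 1 then basis (E k) else 0)"
| "cup_basis_cell (X k) (E l) = (if l = k then basis (E k) else 0)"
| "cup_basis_cell (E k) (E l) = 0"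

instance ..

end

instantiation prod :: (graded_basis, graded_basis) graded_basis
begin

fun deg_prod :: "'a \<times> 'b \<Rightarrow> nat" where
  "deg_prod (s, t) = deg s + deg t"

fun boundary_basis_prod :: "'a \<times> 'b \<Rightarrow> ('a \<times> 'b) form" where
  "boundary_basis_prod (s, t) =
     tensor (boundary_basis s) (basis t) +
     scale ((-1) ^ deg s) (tensor (basis s) (boundary_basis t))"

fun cup_basis_prod :: "'a \<times> 'b \<Rightarrow> 'a \<times> 'b \<Rightarrow> ('a \<times> 'b) form" where
  "cup_basis_prod (s, t) (s', t') =
     scale (if odd (deg t) \<and> odd (deg s') then -1 else 1)
       (tensor (cup_basis s s') (cup_basis t t'))"

instance ..

end

(* Left-nested, as the cup product splits off the last factor. *)

type_synonym cell4 = "((cell \<times> cell) \<times> cell) \<times> cell"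

definition chains :: "'b form set" where
  "chains = {a. finite {s. a s \<noteq> 0}}"

definition boundary :: "'b::graded_basis form \<Rightarrow> 'b form" where
  "boundary a = (\<Sum>s | a s \<noteq> 0. scale (a s) (boundary_basis s))"

definition pairing :: "'b form \<Rightarrow> 'b form \<Rightarrow> real" where
  "pairing a \<omega> = (\<Sum>s | a s \<noteq> 0. a s * \<omega> s)"

definition forms :: "nat \<Rightarrow> 'b::graded_basis form set" where
  "forms r = {\<omega>. \<forall>s. \<omega> s \<noteq> 0 \<longrightarrow> deg s = r}"

(* All degrees at once; it has degree one by coboundary_degree below. *)

definition coboundary :: "'b::graded_basis form \<Rightarrow> 'b form" where
  "coboundary \<omega> = (THE \<eta>. \<forall>a\<in>chains. pairing (boundary a) \<omega> = pairing a \<eta>)"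

(* The bilinear extension to infinite combinations: each basis element u occurs in
   only finitely many products of two basis elements. *)

definition cup :: "'b::graded_basis form \<Rightarrow> 'b form \<Rightarrow> 'b form" where
  "cup \<omega> \<eta> = (\<lambda>u. \<Sum>(s, t) | cup_basis s t u \<noteq> 0. \<omega> s * \<eta> t * cup_basis s t u)"

fun index :: "cell \<Rightarrow> int" where
  "index (X k) = k"
| "index (E k) = k"

fun volume_cell :: "cell4 \<Rightarrow> cell4" where
  "volume_cell (((s0, s1), s2), s3) =
     (((E (index s0), E (index s1)), E (index s2)), E (index s3))"

fun lorentz_sign :: "cell4 \<Rightarrow> real" where
  "lorentz_sign (((s0, s1), s2), s3) = (case s0 of X k \<Rightarrow> 1 | E k \<Rightarrow> -1)"

definition star_basis :: "cell4 \<Rightarrow> cell4 form" where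
  "star_basis s = (THE \<eta>.
     (\<exists>c t. (c = 1 \<or> c = -1) \<and> \<eta> = scale c (basis t)) \<and>
     cup (basis s) \<eta> = scale (lorentz_sign s) (basis (volume_cell s)))"

(* The linear extension to infinite combinations: each t occurs in the star of
   only one s. *)

definition star :: "cell4 form \<Rightarrow> cell4 form" where
  "star \<omega> = (\<lambda>t. \<Sum>s | star_basis s t \<noteq> 0. \<omega> s * star_basis s t)"

(* The argument r is the degree of the form acted upon. *)

definition codifferential :: "nat \<Rightarrow> cell4 form \<Rightarrow> cell4 form" where
  "codifferential r \<psi> =
     (if r = 0 then 0 else scale ((-1) ^ r) (inv star (coboundary (star \<psi>))))"

definition laplacian :: "nat \<Rightarrow> cell4 form \<Rightarrow> cell4 form" where
  "laplacian r \<omega> =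
     - (coboundary (codifferential r \<omega>) + codifferential (r + 1) (coboundary \<omega>))"

definition is_solution ::
  "real \<Rightarrow> cell4 form \<Rightarrow> cell4 form \<Rightarrow> cell4 form \<Rightarrow> cell4 form \<Rightarrow> cell4 form \<Rightarrow> bool" where
  "is_solution m \<omega>0 \<omega>1 \<omega>2 \<omega>3 \<omega>4 \<longleftrightarrow>
     \<omega>0 \<in> forms 0 \<and> \<omega>1 \<in> forms 1 \<and> \<omega>2 \<in> forms 2 \<and> \<omega>3 \<in> forms 3 \<and> \<omega>4 \<in> forms 4 \<and>
     - codifferential 1 \<omega>1 = scale m \<omega>0 \<and>
     coboundary \<omega>0 - codifferential 2 \<omega>2 = 0 \<and>
     coboundary \<omega>1 - codifferential 3 \<omega>3 = scale m \<omega>2 \<and>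
     coboundary \<omega>2 - codifferential 4 \<omega>4 = 0 \<and>
     coboundary \<omega>3 = scale m \<omega>4"

(* The descriptions in coboundary and star_basis are proper, the coboundary has
   degree one and vanishes on forms of degree four, and star is a bijection. *)

lemma boundary_basis_chain_cell: "boundary_basis (s::cell) \<in> chains"
proof (cases s)
  case (E k)
  have "{t. boundary_basis s t \<noteq> 0} \<subseteq> {X (k + 1), X k}"
    by (auto simp: E basis_def)
  then show ?thesis by (simp add: chains_def finite_subset)
qed (simp add: chains_def)

lemma boundary_basis_chain_prod:
  fixes s :: "'a::graded_basis" and t :: "'b::graded_basis"
  assumes "boundary_basis s \<in> chains" and "boundary_basis t \<in> chains"
  shows "boundary_basis (s, t) \<in> chains"
proof -
  have "{u. boundary_basis (s, t) u \<noteq> 0} \<subseteq>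
      {u. boundary_basis s u \<noteq> 0} \<times> {t} \<union> {s} \<times> {u. boundary_basis t u \<noteq> 0}"
    by (auto simp: tensor_def scale_def basis_def split: if_splits)
  then show ?thesis
    using assms by (simp add: chains_def finite_subset)
qed

lemma boundary_basis_chain: "boundary_basis (s::cell4) \<in> chains"
  by (cases s) (auto intro!: boundary_basis_chain_prod boundary_basis_chain_cell
      simp del: boundary_basis_prod.simps)

lemma pairing_superset:
  assumes "finite A" and "{s. a s \<noteq> 0} \<subseteq> A"
  shows "pairing a \<omega> = (\<Sum>s\<in>A. a s * \<omega> s)"
  unfolding pairing_def using assms by (intro sum.mono_neutral_left) auto

lemma sum_fun_apply: "(\<Sum>i\<in>A. f i) x = (\<Sum>i\<in>A. f i x)"
  for f :: "'i \<Rightarrow> 'b \<Rightarrow> real"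
  by (induction A rule: infinite_finite_induct) auto

lemma pairing_boundary:
  fixes a :: "cell4 form"
  assumes "a \<in> chains"
  shows "pairing (boundary a) \<omega> = pairing a (\<lambda>s. pairing (boundary_basis s) \<omega>)"
proof -
  define A where "A = {s. a s \<noteq> 0}"
  define B where "B = (\<Union>s\<in>A. {t. boundary_basis s t \<noteq> 0})"
  have A: "finite A" using assms by (simp add: A_def chains_def)
  have B: "finite B" unfolding B_def using A boundary_basis_chain by (auto simp: chains_def)
  have *: "boundary a t = (\<Sum>s\<in>A. a s * boundary_basis s t)" for t
    by (simp add: boundary_def A_def[symmetric] sum_fun_apply scale_def)
  have sub: "{t. boundary a t \<noteq> 0} \<subseteq> B"
  proof
    fix t assume "t \<in> {t. boundary a t \<noteq> 0}"
    then have "(\<Sum>s\<in>A. a s * boundary_basis s t) \<noteq> 0" by (simp add: *)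
    then obtain s where "s \<in> A" "a s * boundary_basis s t \<noteq> 0" by (rule sum.not_neutral_contains_not_neutral)
    then show "t \<in> B" by (auto simp: B_def)
  qed
  have "pairing (boundary a) \<omega> = (\<Sum>t\<in>B. \<Sum>s\<in>A. a s * (boundary_basis s t * \<omega> t))"
    unfolding pairing_superset[OF B sub] by (simp add: * sum_distrib_right mult.assoc)
  also have "\<dots> = (\<Sum>s\<in>A. a s * (\<Sum>t\<in>B. boundary_basis s t * \<omega> t))"
    by (subst sum.swap) (simp add: sum_distrib_left)
  also have "\<dots> = (\<Sum>s\<in>A. a s * pairing (boundary_basis s) \<omega>)"
  proof (rule sum.cong[OF refl])
    fix s assume "s \<in> A"
    then have "{t. boundary_basis s t \<noteq> 0} \<subseteq> B" by (auto simp: B_def)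
    from pairing_superset[OF B this]
    show "a s * (\<Sum>t\<in>B. boundary_basis s t * \<omega> t) = a s * pairing (boundary_basis s) \<omega>" by simp
  qed
  finally show ?thesis by (simp add: pairing_def A_def)
qed

lemma basis_chain: "basis s \<in> chains"
  by (simp add: chains_def basis_def)

lemma pairing_basis: "pairing (basis s) \<omega> = \<omega> s"
proof -
  have "pairing (basis s) \<omega> = (\<Sum>t\<in>{s}. basis s t * \<omega> t)"
    by (rule pairing_superset) (auto simp: basis_def)
  then show ?thesis by (simp add: basis_def)
qed

lemma coboundary_ex1:
  fixes \<omega> :: "cell4 form"
  shows "\<exists>!\<eta>. \<forall>a\<in>chains. pairing (boundary a) \<omega> = pairing a \<eta>"
proof (rule ex1I)
  show "\<forall>a\<in>chains. pairing (boundary a) \<omega> = pairing a (\<lambda>s. pairing (boundary_basis s) \<omega>)"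
    by (simp add: pairing_boundary)
next
  fix \<eta> assume *: "\<forall>a\<in>chains. pairing (boundary a) \<omega> = pairing a \<eta>"
  show "\<eta> = (\<lambda>s. pairing (boundary_basis s) \<omega>)"
  proof
    fix s
    have "\<eta> s = pairing (boundary (basis s)) \<omega>" using * basis_chain pairing_basis by metis
    also have "\<dots> = pairing (boundary_basis s) \<omega>"
      by (simp add: pairing_boundary basis_chain pairing_basis)
    finally show "\<eta> s = pairing (boundary_basis s) \<omega>" .
  qed
qed

lemma coboundary_adjoint:
  fixes a \<omega> :: "cell4 form"
  assumes "a \<in> chains"
  shows "pairing (boundary a) \<omega> = pairing a (coboundary \<omega>)"
  using theI'[OF coboundary_ex1, of \<omega>] assms unfolding coboundary_def by blast

lemma coboundary_apply:
  fixes \<omega> :: "cell4 form"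
  shows "coboundary \<omega> s = pairing (boundary_basis s) \<omega>"
proof -
  have "coboundary \<omega> s = pairing (boundary (basis s)) \<omega>"
    by (simp add: coboundary_adjoint basis_chain pairing_basis)
  then show ?thesis by (simp add: pairing_boundary basis_chain pairing_basis)
qed

lemma deg_boundary_cell:
  "boundary_basis s t \<noteq> 0 \<Longrightarrow> deg s = deg t + 1" for s t :: cell
  by (cases s) (auto simp: basis_def split: if_splits)

lemma deg_boundary_prod:
  fixes s t :: "'a::graded_basis \<times> 'b::graded_basis"
  assumes "\<And>s t :: 'a. boundary_basis s t \<noteq> 0 \<Longrightarrow> deg s = deg t + 1"
    and "\<And>s t :: 'b. boundary_basis s t \<noteq> 0 \<Longrightarrow> deg s = deg t + 1"
    and "boundary_basis s t \<noteq> 0"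
  shows "deg s = deg t + 1"
proof -
  have z: "boundary_basis a a = 0" "boundary_basis b b = 0" for a :: 'a and b :: 'b
    using assms(1)[of a a] assms(2)[of b b] by auto
  show ?thesis using assms(3)
  by (cases s; cases t)
    (auto simp: tensor_def scale_def basis_def z split: if_splits dest: assms(1,2))
qed

lemma deg_boundary: "boundary_basis s t \<noteq> 0 \<Longrightarrow> deg s = deg t + 1" for s t :: cell4
  by (rule deg_boundary_prod[OF deg_boundary_prod[OF deg_boundary_prod[OF deg_boundary_cell deg_boundary_cell] deg_boundary_cell] deg_boundary_cell])

lemma coboundary_degree:
  fixes \<omega> :: "cell4 form"
  assumes "\<omega> \<in> forms r"
  shows "coboundary \<omega> \<in> forms (r + 1)"
proof -
  have "deg s = r + 1" if s: "coboundary \<omega> s \<noteq> 0" for s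
  proof -
    obtain t where "boundary_basis s t * \<omega> t \<noteq> 0"
      using s unfolding coboundary_apply pairing_def
      by (rule sum.not_neutral_contains_not_neutral)
    then have "boundary_basis s t \<noteq> 0" "\<omega> t \<noteq> 0" by auto
    moreover from this have "deg t = r" using assms unfolding forms_def by blast
    ultimately show ?thesis using deg_boundary[of s t] by simp
  qed
  then show ?thesis unfolding forms_def by blast
qed

lemma deg_cell_le: "deg (s::cell) \<le> 1" by (cases s) auto

lemma forms_above_4: "(\<omega>::cell4 form) \<in> forms r \<Longrightarrow> r > 4 \<Longrightarrow> \<omega> = 0"
proof -
  assume a: "\<omega> \<in> forms r" "r > 4"
  have "deg (s::cell4) \<le> 4" for s
  proof -
    obtain a b c d where s: "s = (((a, b), c), d)" by (metis surj_pair)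
    show ?thesis using deg_cell_le[of a] deg_cell_le[of b] deg_cell_le[of c] deg_cell_le[of d]
      by (simp add: s)
  qed
  then have "deg s \<noteq> r" for s :: cell4 using a(2) by (metis not_le)
  then have "\<omega> s = 0" for s using a(1) unfolding forms_def by blast
  then show ?thesis by (simp add: fun_eq_iff)
qed

lemma coboundary_top: "(\<omega>::cell4 form) \<in> forms 4 \<Longrightarrow> coboundary \<omega> = 0"
  using coboundary_degree forms_above_4 by fastforce

lemma finite_cup_cell: "finite {(s, t). cup_basis s t (u::cell) \<noteq> 0}"
proof -
  have "{(s, t). cup_basis s t u \<noteq> 0} \<subseteq>
      {(X (index u), X (index u)), (E (index u), X (index u + 1)), (X (index u), E (index u))}"
  proof
    fix p assume p: "p \<in> {(s, t). cup_basis s t u \<noteq> 0}"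
    obtain s t where "p = (s, t)" by (cases p)
    with p show "p \<in> {(X (index u), X (index u)), (E (index u), X (index u + 1)), (X (index u), E (index u))}"
      by (cases s; cases t) (auto simp: basis_def split: if_splits)
  qed
  then show ?thesis using finite_subset by blast
qed

lemma finite_cup_prod:
  assumes "finite {(s, t). cup_basis s t (u::'a::graded_basis) \<noteq> 0}"
    and "finite {(s, t). cup_basis s t (v::'b::graded_basis) \<noteq> 0}"
  shows "finite {(s, t). cup_basis s t (u, v) \<noteq> 0}"
proof -
  have "{(s, t). cup_basis s t (u, v) \<noteq> 0} \<subseteq>
    (\<lambda>((s, s'), (t, t')). ((s, t), (s', t'))) `
      ({(s, t). cup_basis s t u \<noteq> 0} \<times> {(s, t). cup_basis s t v \<noteq> 0})"
    by (auto simp: tensor_def scale_def image_iff split: if_splits) 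
  then show ?thesis using assms finite_subset by blast
qed

lemma finite_cup: "finite {(s, t). cup_basis s t (u::cell4) \<noteq> 0}"
  by (cases u) (auto intro!: finite_cup_prod finite_cup_cell simp del: cup_basis_prod.simps)

lemma cup_basis_eq: "cup (basis s) (scale c (basis t)) = scale c (cup_basis s (t::cell4))"
proof
  fix u :: cell4
  let ?S = "{(s, t). cup_basis s t u \<noteq> 0}"
  have "cup (basis s) (scale c (basis t)) u =
     (\<Sum>p\<in>?S. case p of (a,b) \<Rightarrow> basis s a * scale c (basis t) b * cup_basis a b u)"
    by (simp add: cup_def)
  also have "\<dots> = (\<Sum>p\<in>{(s,t)}. case p of (a,b) \<Rightarrow> basis s a * scale c (basis t) b * cup_basis a b u)"
    by (rule sum.mono_neutral_cong) (auto simp: finite_cup basis_def scale_def simp del: cup_basis_prod.simps split_paired_All split: if_splits)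
  finally show "cup (basis s) (scale c (basis t)) u = scale c (cup_basis s t) u"
    by (simp add: basis_def scale_def)
qed

fun dual :: "cell \<Rightarrow> cell" where
  "dual (X k) = E k"
| "dual (E k) = X (k + 1)"

fun dual4 :: "cell4 \<Rightarrow> cell4" where
 "dual4 (((a,b),c),d) = (((dual a, dual b), dual c), dual d)"

lemma cup_cell:
  "t \<noteq> dual s \<Longrightarrow> cup_basis s t (E (index s)) = 0"
  "cup_basis s (dual s) = basis (E (index s))"
  by (cases s; cases t; auto simp: basis_def fun_eq_iff)+

lemma tensor_basis: "tensor (basis a) (basis b) = basis (a,b)"
  by (auto simp: tensor_def basis_def fun_eq_iff)

lemma tensor_scale: "tensor (scale c f) g = scale c (tensor f g)"
  by (auto simp: tensor_def scale_def fun_eq_iff)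

lemma scale_scale: "scale a (scale b f) = scale (a * b) f"
  by (simp add: scale_def mult.assoc)

lemma star_basis_ex1: "\<exists>!\<eta>.
     (\<exists>c t. (c = 1 \<or> c = -1) \<and> \<eta> = scale c (basis t)) \<and>
     cup (basis s) \<eta> = scale (lorentz_sign s) (basis (volume_cell s))" (is "\<exists>!\<eta>. ?P \<eta>")
  and star_basis_form: "\<exists>c. (c = 1 \<or> c = -1) \<and> star_basis s = scale c (basis (dual4 s))"
proof -
  obtain a b c d where s: "s = (((a, b), c), d)" by (metis surj_pair)
  obtain e where e: "e = 1 \<or> e = -1" "cup_basis s (dual4 s) = scale e (basis (volume_cell s))"
  proof -
    have "\<exists>f g h :: real. cup_basis s (dual4 s) = scale (f * (g * h)) (basis (volume_cell s)) \<and>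
       (f = 1 \<or> f = -1) \<and> (g = 1 \<or> g = -1) \<and> (h = 1 \<or> h = -1)"
      unfolding s dual4.simps cup_basis_prod.simps cup_cell(2) tensor_basis tensor_scale scale_scale volume_cell.simps
      by (rule exI, rule exI, rule exI, rule conjI, rule refl) auto
    then obtain f g h :: real where "f = 1 \<or> f = -1" "g = 1 \<or> g = -1" "h = 1 \<or> h = -1"
      "cup_basis s (dual4 s) = scale (f * (g * h)) (basis (volume_cell s))" by blast
    moreover from this have "f * (g * h) = 1 \<or> f * (g * h) = -1" by (elim disjE) simp_all
    ultimately show ?thesis using that by blast
  qed
  have q: "lorentz_sign s = 1 \<or> lorentz_sign s = -1" by (cases a) (auto simp: s)
  let ?\<eta> = "scale (lorentz_sign s * e) (basis (dual4 s))"
  have pm: "lorentz_sign s * e = 1 \<or> lorentz_sign s * e = -1" using e(1) q by auto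
  have ee: "e * e = 1" using e(1) by auto
  have "cup (basis s) ?\<eta> = scale (lorentz_sign s) (basis (volume_cell s))"
    unfolding cup_basis_eq e(2) scale_scale mult.assoc ee by simp
  with pm have 1: "?P ?\<eta>" by blast
  have 2: "\<eta> = ?\<eta>" if P: "?P \<eta>" for \<eta>
  proof -
    obtain f t where f: "f = 1 \<or> f = -1" "\<eta> = scale f (basis t)"
      "cup (basis s) \<eta> = scale (lorentz_sign s) (basis (volume_cell s))" using P by blast
    then have g: "scale f (cup_basis s t) = scale (lorentz_sign s) (basis (volume_cell s))"
      by (simp add: cup_basis_eq)
    obtain a' b' c' d' where t: "t = (((a', b'), c'), d')" by (metis surj_pair)
    have "cup_basis s t (volume_cell s) \<noteq> 0"
      using fun_cong[OF g, of "volume_cell s"] q f by (auto simp: scale_def basis_def)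
    then have "t = dual4 s" using cup_cell(1) by (auto simp: s t scale_def tensor_def split: if_splits)
    moreover have "f * e = lorentz_sign s"
      using fun_cong[OF g, of "volume_cell s"] e \<open>t = dual4 s\<close> by (simp add: scale_def basis_def)
    ultimately have "f = lorentz_sign s * e" using e(1) by auto
    then show ?thesis using f(2) \<open>t = dual4 s\<close> by simp
  qed
  show "\<exists>!\<eta>. ?P \<eta>" using 1 2 by (rule ex1I)
  have "star_basis s = ?\<eta>" unfolding star_basis_def using 1 2 by (rule the_equality)
  then show "\<exists>c. (c = 1 \<or> c = -1) \<and> star_basis s = scale c (basis (dual4 s))"
    using pm by blast
qed

lemma bij_dual4: "bij dual4"
proof (rule bijI)
  have i: "dual a = dual b \<Longrightarrow> a = b" for a b by (cases a; cases b) auto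
  show "inj dual4" by (auto simp: inj_def dest: i)
  have e: "\<exists>x. y = dual x" for y :: cell by (cases y) (metis dual.simps diff_add_cancel)+
  show "surj dual4" unfolding surj_def
  proof
    fix y :: cell4
    obtain a b c d where y: "y = (((a, b), c), d)" by (metis surj_pair)
    obtain a' b' c' d' where "a = dual a'" "b = dual b'" "c = dual c'" "d = dual d'" by (metis e)
    then have "y = dual4 (((a', b'), c'), d')" by (simp add: y)
    then show "\<exists>x. y = dual4 x" ..
  qed
qed

lemma bij_star: "bij star"
proof -
  obtain c where c: "\<And>s. c s = 1 \<or> c s = (-1::real)" "\<And>s. star_basis s = scale (c s) (basis (dual4 s))"
    using star_basis_form by metis
  have v: "star \<omega> (dual4 s) = c s * \<omega> s" for \<omega> s
  proof -
    have "{s'. star_basis s' (dual4 s) \<noteq> 0} = {s}"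
    proof (intro set_eqI iffI)
      fix s' assume "s' \<in> {s'. star_basis s' (dual4 s) \<noteq> 0}"
      then have "dual4 s = dual4 s'" by (simp add: c(2) scale_def basis_def split: if_splits)
      then show "s' \<in> {s}" using bij_dual4 by (simp add: bij_def inj_eq)
    next
      fix s' assume "s' \<in> {s}"
      then show "s' \<in> {s'. star_basis s' (dual4 s) \<noteq> 0}"
        using c(1)[of s] by (auto simp: c(2) scale_def basis_def)
    qed
    then show ?thesis by (simp add: star_def c(2) scale_def basis_def)
  qed
  show ?thesis
  proof (rule bijI)
    show "inj star"
    proof (rule injI, rule ext)
      fix x y s assume "star x = star y"
      then show "x s = y s" using v[of x s] v[of y s] c(1)[of s] by auto
    qed
    show "surj star" unfolding surj_def
    proof
      fix y :: "cell4 form"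
      have "y = star (\<lambda>s. c s * y (dual4 s))"
      proof
        fix t obtain s where "t = dual4 s" using bij_dual4 by (metis bij_pointE)
        then show "y t = star (\<lambda>s. c s * y (dual4 s)) t" using v c(1)[of s] by auto
      qed
      then show "\<exists>x. y = star x" by blast
    qed
  qed
qed

end

theory Submission
  imports Defs
begin

text \<open>
  A gauge term changes an equation of the system only through \<open>d\<^sup>cd\<^sup>c\<close>, \<open>\<delta>\<^sup>c\<delta>\<^sup>c\<close>,
  \<open>\<delta>\<^sup>cd\<^sup>c\<phi>\<close> for \<open>\<phi>\<close> of degree 0, or \<open>d\<^sup>c\<delta>\<^sup>c\<phi>\<close> for \<open>\<phi>\<close> of degree 4.  The first two vanish
  because \<open>d\<^sup>cd\<^sup>c = 0\<close>; in the extreme degrees the Laplacian has a single summand, so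
  harmonicity is exactly the vanishing of the last two.
\<close>

text \<open>Cancellation can make the support of the sum smaller than the union of the two supports,
  so all three pairings are first written over that union, which is finite for chains.\<close>

lemma pairing_add_left:
  assumes "a \<in> chains" and "b \<in> chains"
  shows "pairing (a + b) \<omega> = pairing a \<omega> + pairing b \<omega>"
proof -
  define A where "A = {s. a s \<noteq> 0} \<union> {s. b s \<noteq> 0}"
  have "finite A" using assms by (simp add: A_def chains_def)
  then have "pairing c \<omega> = (\<Sum>s\<in>A. c s * \<omega> s)" if "{s. c s \<noteq> 0} \<subseteq> A" for c
    using that by (rule pairing_superset)
  moreover have "{s. a s \<noteq> 0} \<subseteq> A" "{s. b s \<noteq> 0} \<subseteq> A" "{s. (a + b) s \<noteq> 0} \<subseteq> A"
    by (auto simp: A_def)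
  ultimately show ?thesis by (simp add: distrib_right sum.distrib)
qed

lemma pairing_scale_left: "pairing (scale c a) \<omega> = c * pairing a \<omega>"
  \<comment> \<open>Scaling by zero empties the support over which \<open>pairing\<close> sums; any
    other factor leaves it unchanged.\<close>
  by (cases "c = 0") (simp_all add: pairing_def scale_def sum_distrib_left mult.assoc)

lemma pairing_add_right: "pairing a (\<omega> + \<eta>) = pairing a \<omega> + pairing a \<eta>"
  by (simp add: pairing_def distrib_left sum.distrib)

lemma pairing_scale_right: "pairing a (scale c \<omega>) = c * pairing a \<omega>"
  by (simp add: pairing_def scale_def sum_distrib_left mult.left_commute)

lemma scale_chains: "a \<in> chains \<Longrightarrow> scale c a \<in> chains"
  unfolding chains_def scale_def by (auto elim: rev_finite_subset)

lemma tensor_support: "{u. tensor a b u \<noteq> 0} = {s. a s \<noteq> 0} \<times> {t. b t \<noteq> 0}"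
  by (auto simp: tensor_def)

lemma tensor_chains: "a \<in> chains \<Longrightarrow> b \<in> chains \<Longrightarrow> tensor a b \<in> chains"
  by (simp add: chains_def tensor_support)

lemma pairing_tensor: "pairing (tensor a b) \<omega> = pairing a (\<lambda>s. pairing b (\<lambda>t. \<omega> (s, t)))"
  unfolding pairing_def tensor_support sum_distrib_left sum.cartesian_product
  by (rule sum.cong) (auto simp: tensor_def)

text \<open>The Leibniz rule in dual form. Applied factor by factor, it reduces the coboundary on a
  product cell to signed differences in single factors.\<close>

lemma pairing_boundary_basis_prod:
  assumes "boundary_basis s \<in> chains" and "boundary_basis t \<in> chains"
  shows "pairing (boundary_basis (s, t)) \<omega> =
    pairing (boundary_basis s) (\<lambda>u. \<omega> (u, t)) +
    (-1) ^ deg s * pairing (boundary_basis t) (\<lambda>u. \<omega> (s, u))"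
  using assms
  by (simp add: pairing_add_left pairing_scale_left scale_chains tensor_chains basis_chain
      pairing_tensor pairing_basis)

lemma pairing_boundary_basis_X: "pairing (boundary_basis (X k)) \<omega> = 0"
  by (simp add: pairing_def)

lemma pairing_boundary_basis_E:
  "pairing (boundary_basis (E k)) \<omega> = \<omega> (X (k + 1)) - \<omega> (X k)"
proof -
  \<comment> \<open>Subtraction is recast as addition of a multiple, to fit the linearity rules for
    \<open>pairing\<close>.\<close>
  have "boundary_basis (E k) = basis (X (k + 1)) + scale (-1) (basis (X k))"
    by (simp add: scale_def fun_eq_iff)
  then show ?thesis
    by (simp add: pairing_add_left basis_chain scale_chains pairing_scale_left pairing_basis
        del: boundary_basis_cell.simps)
qed

lemma coboundary_add: "coboundary (\<omega> + \<eta>) = coboundary \<omega> + coboundary \<eta>"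
  for \<omega> \<eta> :: "cell4 form"
  by (simp add: fun_eq_iff coboundary_apply pairing_add_right)

lemma coboundary_scale: "coboundary (scale c \<omega>) = scale c (coboundary \<omega>)"
  for \<omega> :: "cell4 form"
  by (simp add: fun_eq_iff coboundary_apply pairing_scale_right scale_def[of _ "coboundary \<omega>"])

lemma coboundary_zero: "coboundary (0 :: cell4 form) = 0"
  using coboundary_add[of 0 0] by simp

text \<open>Two boundaries in the same factor give zero, since the boundary of an \<open>E\<close>
  consists of \<open>X\<close> cells. In two different factors the differences commute, and the
  Leibniz signs make the two orders cancel.\<close>

lemma coboundary_coboundary: "coboundary (coboundary \<omega>) = 0"
  for \<omega> :: "cell4 form"
proof
  fix s :: cell4
  obtain a b c d where s: "s = (((a, b), c), d)" by (metis surj_pair)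
  have "pairing (boundary_basis s) (\<lambda>t. pairing (boundary_basis t) \<omega>) = 0"
    unfolding s
    \<comment> \<open>Sixteen cell types, each an explicit identity between values of
      \<open>\<omega>\<close>.\<close>
    by (cases a; cases b; cases c; cases d)
      (simp_all add: pairing_boundary_basis_prod boundary_basis_chain_prod
        boundary_basis_chain_cell pairing_boundary_basis_X pairing_boundary_basis_E
        del: boundary_basis_prod.simps boundary_basis_cell.simps)
  then show "coboundary (coboundary \<omega>) s = 0 s"
    by (simp add: coboundary_apply[abs_def])
qed

text \<open>Up to signs, \<open>star\<close> permutes coefficients along \<open>dual4\<close>.
  Linearity and the effect on degrees follow without computing the signs.\<close>

lemma star_dual4_ex:
  obtains c where "\<And>s. c s = 1 \<or> c s = (-1::real)"
    and "\<And>\<omega> s. star \<omega> (dual4 s) = c s * \<omega> s"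
proof -
  obtain c where c: "\<And>s. c s = 1 \<or> c s = (-1::real)"
      "\<And>s. star_basis s = scale (c s) (basis (dual4 s))"
    using star_basis_form by metis
  have "star \<omega> (dual4 s) = c s * \<omega> s" for \<omega> s
  proof -
    have "c s \<noteq> 0" using c(1)[of s] by auto
    then have "{s'. star_basis s' (dual4 s) \<noteq> 0} = {s}"
      using bij_dual4 by (auto simp: c(2) scale_def basis_def bij_def inj_eq split: if_splits)
    then show ?thesis by (simp add: star_def c(2) scale_def basis_def)
  qed
  with c(1) show ?thesis by (rule that)
qed

lemma all_dual4: "(\<forall>t. P t) \<longleftrightarrow> (\<forall>s. P (dual4 s))"
  using bij_dual4 by (metis bij_pointE)

lemma dual4_form_eqI: "(\<And>s. \<omega> (dual4 s) = \<eta> (dual4 s)) \<Longrightarrow> \<omega> = \<eta>"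
  unfolding fun_eq_iff by (subst all_dual4) blast

lemma star_add: "star (\<omega> + \<eta>) = star \<omega> + star \<eta>"
  by (rule star_dual4_ex, rule dual4_form_eqI) (simp add: distrib_left)

lemma star_scale: "star (scale c \<omega>) = scale c (star \<omega>)"
  by (rule star_dual4_ex, rule dual4_form_eqI) (simp add: scale_def)

lemma star_inv_star: "star (inv star \<omega>) = \<omega>"
  using bij_star by (simp add: bij_is_surj surj_f_inv_f)

lemma inv_star_eqI: "star \<eta> = \<omega> \<Longrightarrow> inv star \<omega> = \<eta>"
  using bij_star by (auto simp: bij_is_inj)

lemma inv_star_add: "inv star (\<omega> + \<eta>) = inv star \<omega> + inv star \<eta>"
  by (rule inv_star_eqI) (simp add: star_add star_inv_star)

lemma inv_star_zero: "inv star 0 = 0"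
  using inv_star_add[of 0 0] by simp

lemma deg_dual4: "deg (dual4 s) + deg s = 4"
proof -
  have cell: "deg (dual a) + deg a = 1" for a by (cases a) auto
  obtain a b c d where "s = (((a, b), c), d)" by (metis surj_pair)
  then show ?thesis using cell[of a] cell[of b] cell[of c] cell[of d] by simp
qed

text \<open>The signs are nonzero, so \<open>dual4\<close> carries the support of a form onto that
  of its star, and it turns degree r into 4 - r. The converse direction serves to read off degrees
  of \<open>inv star\<close>.\<close>

lemma star_forms_iff:
  assumes "r + q = 4"
  shows "star \<omega> \<in> forms q \<longleftrightarrow> \<omega> \<in> forms r"
proof -
  obtain c where c: "\<And>s. c s = 1 \<or> c s = (-1::real)"
    "\<And>\<omega> s. star \<omega> (dual4 s) = c s * \<omega> s" by (rule star_dual4_ex) blast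
  have nz: "star \<omega> (dual4 s) \<noteq> 0 \<longleftrightarrow> \<omega> s \<noteq> 0" for s
    using c(1)[of s] by (auto simp: c(2))
  have deg: "deg (dual4 s) = q \<longleftrightarrow> deg s = r" for s
    using deg_dual4[of s] assms by linarith
  have "star \<omega> \<in> forms q \<longleftrightarrow> (\<forall>s. star \<omega> (dual4 s) \<noteq> 0 \<longrightarrow> deg (dual4 s) = q)"
    unfolding forms_def mem_Collect_eq by (rule all_dual4)
  then show ?thesis unfolding nz deg by (simp add: forms_def)
qed

lemma scale_zero: "scale c 0 = 0"
  by (simp add: scale_def fun_eq_iff)

lemma scale_forms: "\<omega> \<in> forms r \<Longrightarrow> scale c \<omega> \<in> forms r"
  by (auto simp: forms_def scale_def)

lemma add_forms: "\<omega> \<in> forms r \<Longrightarrow> \<eta> \<in> forms r \<Longrightarrow> \<omega> + \<eta> \<in> forms r"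
  unfolding forms_def by (auto, metis add_0_left)

text \<open>Through \<open>star\<close>, \<open>coboundary\<close> and \<open>inv star\<close> the
  degree runs from r + 1 to 3 - r, then 4 - r, then r.\<close>

lemma codifferential_degree:
  assumes "\<omega> \<in> forms (Suc r)" and "r \<le> 3"
  shows "codifferential (Suc r) \<omega> \<in> forms r"
proof -
  have "star \<omega> \<in> forms (3 - r)"
    using assms star_forms_iff[of "Suc r" "3 - r" \<omega>] by simp
  moreover have "3 - r + 1 = 4 - r" using assms(2) by simp
  ultimately have "star (inv star (coboundary (star \<omega>))) \<in> forms (4 - r)"
    unfolding star_inv_star using coboundary_degree by metis
  then show ?thesis
    using assms(2) star_forms_iff[of r "4 - r"] by (simp add: codifferential_def scale_forms)
qed

lemma codifferential_add:
  "codifferential r (\<omega> + \<eta>) = codifferential r \<omega> + codifferential r \<eta>"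
  by (simp add: codifferential_def star_add coboundary_add inv_star_add)
    (simp add: scale_def fun_eq_iff distrib_left)

lemma codifferential_zero: "codifferential r 0 = 0"
  using codifferential_add[of r 0 0] by simp

text \<open>The outer \<open>star\<close> cancels the inner \<open>inv star\<close>, which leaves
  two successive coboundaries. In degree 0 the codifferential is zero by definition.\<close>

lemma codifferential_codifferential: "codifferential q (codifferential r \<omega>) = 0"
proof (cases "r = 0")
  case False
  have "coboundary (star (codifferential r \<omega>)) = 0"
    using False
    by (simp add: codifferential_def star_scale star_inv_star coboundary_scale
        coboundary_coboundary scale_zero)
  then show ?thesis
    by (simp add: codifferential_def[of q] inv_star_zero scale_zero)
qed (simp add: codifferential_def[of 0] codifferential_zero)

lemma laplacian_bottom: "laplacian 0 \<omega> = - codifferential 1 (coboundary \<omega>)"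
  by (simp add: laplacian_def codifferential_def[of 0] coboundary_zero)

lemma laplacian_top:
  "\<omega> \<in> forms 4 \<Longrightarrow> laplacian 4 \<omega> = - coboundary (codifferential 4 \<omega>)"
  by (simp add: laplacian_def coboundary_top codifferential_zero)

theorem proposition6p3:
  fixes m1 :: real
    and \<omega>0 \<omega>1 \<omega>2 \<omega>3 \<omega>4 \<phi>0 \<phi>4 :: "cell4 form"
  assumes "m1 \<noteq> 0"
    and "\<omega>0 \<in> forms 0" and "\<omega>1 \<in> forms 1" and "\<omega>2 \<in> forms 2"
    and "\<omega>3 \<in> forms 3" and "\<omega>4 \<in> forms 4"
    and "\<phi>0 \<in> forms 0" and "\<phi>4 \<in> forms 4"
    and "laplacian 0 \<phi>0 = 0" and "laplacian 4 \<phi>4 = 0"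
  shows "is_solution m1 \<omega>0 \<omega>1 \<omega>2 \<omega>3 \<omega>4 \<longleftrightarrow>
    is_solution m1 \<omega>0 (\<omega>1 + coboundary \<phi>0) \<omega>2 (\<omega>3 + codifferential 4 \<phi>4) \<omega>4"
proof -
  have "codifferential 1 (coboundary \<phi>0) = 0"
    using assms(9) by (simp add: laplacian_bottom)
  moreover have "coboundary (codifferential 4 \<phi>4) = 0"
    using assms(10) by (simp add: laplacian_top assms(8))
  \<comment> \<open>\<open>is_solution\<close> also records degrees, so the shifted forms must be
    shown to keep theirs.\<close>
  moreover have "\<omega>1 + coboundary \<phi>0 \<in> forms 1"
    using coboundary_degree[OF assms(7)] assms(3) by (simp add: add_forms)
  moreover have "\<omega>3 + codifferential 4 \<phi>4 \<in> forms 3"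
    using codifferential_degree[of \<phi>4 3] assms(5,8) by (simp add: add_forms)
  ultimately show ?thesis
    using assms(3,5)
    \<comment> \<open>By additivity every gauge term vanishes, so each shifted equation becomes the
      original one and both directions follow at once.\<close>
    by (simp add: is_solution_def coboundary_add codifferential_add coboundary_coboundary
        codifferential_codifferential)
qed

end
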